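(* Let $n>0$. The set $\mathcal{ST}(n)$ of semi-tribonacci partitions of $n$ consists of all partitions $\lambda$ of $n$ satisfying the following conditions: (a) $v_1(\lambda)$ has multiplicity one in $v(\lambda)$ (i.e. it occurs exactly once in the sequence $v(\lambda)$); (b) if $1<j\leq \ell(\lambda)$, then $v_j(\lambda)$ has multiplicity one or three in $v(\lambda)$; (c) if $v_j(\lambda)$ has multiplicity three in $v(\lambda)$, then $\lambda$ has at least two parts equal to $2^{v_j(\lambda)}$.
   Context: A partition of $n$ is a weakly decreasing sequence (equivalently, a finite multiset) of positive integers with sum $n$; its length $\ell(\lambda)$ is its number of parts. $\mathrm{val}_2(m)$ is the $2$-adic valuation of the positive integer $m$. For a partition $\lambda=(\lambda_1,\ldots,\lambda_{\ell(\lambda)})$, $v(\lambda)=(v_1(\lambda),\ldots,v_{\ell(\lambda)}(\lambda))$ is the sequence obtained by arranging the numbers $\mathrm{val}_2(\lambda_i)$, $1\le i\le \ell(\lambda)$, in non-increasing order. Notation: $\lambda\sqcup\mu$ is the partition whose multiset of parts is the multiset union (multiplicities added) of the parts of $\lambda$ and $\mu$; $2\lambda$ is obtained by doubling every part of $\lambda$; if $\lambda$ has an odd part, $\lambda^{o+2}$ is obtained by adding $2$ to (one occurrence of) the largest odd part of $\lambda$. For a set $\mathcal S$ of partitions these operations are applied elementwise: $\mathcal S\sqcup\mu=\{\lambda\sqcup\mu\mid\lambda\in\mathcal S\}$, $2\mathcal S=\{2\lambda\mid\lambda\in\mathcal S\}$, $\mathcal S^{o+2}=\{\lambda^{o+2}\mid\lambda\in\mathcal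 S\}$ (all empty if $\mathcal S=\emptyset$). The semi-tribonacci partitions are defined recursively by $\mathcal{ST}(0)=\emptyset$, $\mathcal{ST}(1)=\{(1)\}$, $\mathcal{ST}(3)=\{(3),(2,1)\}$, and for $n\ge1$: $\mathcal{ST}(2n)=2\,\mathcal{ST}(n)$ and $\mathcal{ST}(2n+3)=\big(\mathcal{ST}(2n+2)\sqcup(1)\big)\cup \mathcal{ST}(2n+1)^{o+2}\cup\big(\mathcal{ST}(2n)\sqcup(1,1,1)\big)$. *)

theory Defs
  imports "HOL-Library.Multiset" "HOL-Computational_Algebra.Primes"
begin

text \<open>Partitions are finite multisets of positive integers, so \<open>\<mu> \<squnion> \<nu>\<close> is multiset addition
  and the length of a partition is the size of the multiset.\<close>

definition partitions :: "nat \<Rightarrow> nat multiset set" where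
  "partitions n = {\<mu>. 0 \<notin># \<mu> \<and> \<Sum>\<^sub># \<mu> = n}"

definition val_seq :: "nat multiset \<Rightarrow> nat list" where
  "val_seq \<mu> = rev (sorted_list_of_multiset (image_mset (multiplicity 2) \<mu>))"

text \<open>The entries of the sequence are indexed from 1, so \<open>v \<mu> j\<close> is meaningful
  only for \<open>1 \<le> j \<le> size \<mu>\<close>.\<close>

definition v :: "nat multiset \<Rightarrow> nat \<Rightarrow> nat" where
  "v \<mu> j = val_seq \<mu> ! (j - 1)"

definition double :: "nat multiset \<Rightarrow> nat multiset" where
  "double \<mu> = image_mset (\<lambda>k. 2 * k) \<mu>"

definition largest_odd_part :: "nat multiset \<Rightarrow> nat" where
  "largest_odd_part \<mu> = Max {k. k \<in># \<mu> \<and> odd k}"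

text \<open>\<open>\<mu>\<^sup>o\<^sup>+\<^sup>2\<close>; only meaningful if \<open>\<mu>\<close> has an odd part, as every partition of
  an odd number does.\<close>

definition odd_plus_two :: "nat multiset \<Rightarrow> nat multiset" where
  "odd_plus_two \<mu> = add_mset (largest_odd_part \<mu> + 2) (\<mu> - {#largest_odd_part \<mu>#})"

lemma double_neq_3: "2 * m \<noteq> (3 :: nat)" by presburger

lemma double_neq_double_plus_3: "2 * m \<noteq> 2 * n + (3 :: nat)" by presburger

function ST :: "nat \<Rightarrow> nat multiset set" where
  "ST 0 = {}"
| "ST 1 = {{#1#}}"
| "ST 3 = {{#3#}, {#2, 1#}}"
| "n \<ge> 1 \<Longrightarrow> ST (2 * n) = double ` ST n"
| "n \<ge> 1 \<Longrightarrow> ST (2 * n + 3) =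
     (\<lambda>\<nu>. \<nu> + {#1#}) ` ST (2 * n + 2) \<union>
     odd_plus_two ` ST (2 * n + 1) \<union>
     (\<lambda>\<nu>. \<nu> + {#1, 1, 1#}) ` ST (2 * n)"
proof -
  fix P :: bool and x :: nat
  assume 0: "x = 0 \<Longrightarrow> P" and 1: "x = 1 \<Longrightarrow> P" and 3: "x = 3 \<Longrightarrow> P"
    and ev: "\<And>n. n \<ge> 1 \<Longrightarrow> x = 2 * n \<Longrightarrow> P"
    and od: "\<And>n. n \<ge> 1 \<Longrightarrow> x = 2 * n + 3 \<Longrightarrow> P"
  have "x = 0 \<or> x = 1 \<or> x = 3 \<or> (\<exists>n\<ge>1. x = 2 * n) \<or> (\<exists>n\<ge>1. x = 2 * n + 3)"
    by presburger
  then show P using 0 1 3 ev od by blast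
qed (simp_all add: double_neq_double_plus_3 double_neq_3)
termination
  by (relation "Wellfounded.measure id") auto

end

theory Submission
  imports Defs
begin

text \<open>
  Separate a partition into its even parts, written as \<open>double \<nu>\<close>, and its odd parts \<open>\<rho>\<close>.
  The valuations of \<open>double \<nu>\<close> are those of \<open>\<nu>\<close> shifted by one, so, for nonempty \<open>\<nu>\<close>,
  conditions (a)--(c) on \<open>double \<nu> + \<rho>\<close> turn into the same conditions on \<open>\<nu>\<close> together with a
  condition on the valuation 0, i.e. on \<open>\<rho>\<close> alone (\<open>admissible_double_plus_odd\<close>). The number
  of odd parts is 0, 1 or 3. If the sum is even, it is 0, which gives
  \<open>ST (2 * n) = double ` ST n\<close>. If the sum is odd, the odd parts are a single \<open>r\<close> or
  \<open>r, 1, 1\<close>, where \<open>r\<close> is the largest (\<open>admissible_odd_sum_iff\<close>).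

  Suppose that this odd sum is at least 5. If \<open>r = 1\<close>, deleting all the odd parts leaves a
  nonempty admissible partition into even parts, and this accounts for the two outer terms of
  the recursion for \<open>ST (2 * n + 3)\<close>. If \<open>r \<ge> 3\<close>, then \<open>r\<close> may be lowered to \<open>r - 2\<close>,
  which is still a largest odd part, so that \<open>odd_plus_two\<close> undoes this change: that is the
  middle term. Hence the admissible partitions satisfy the recursion that defines \<open>ST\<close>.
\<close>

section \<open>Conditions (a)--(c) in terms of multiplicities of valuations\<close>

definition val_count :: "nat multiset \<Rightarrow> nat \<Rightarrow> nat" where
  "val_count \<mu> k = size {#x \<in># \<mu>. multiplicity 2 x = k#}"

text \<open>The valuation \<open>m\<close> below is the largest one that occurs. Quantifying over it instead of
  naming it as a maximum makes the condition stable under a shift of all valuations.\<close>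

definition admissible :: "nat multiset \<Rightarrow> bool" where
  "admissible \<mu> \<longleftrightarrow> 0 \<notin># \<mu> \<and>
     (\<exists>m. val_count \<mu> m = 1 \<and> (\<forall>k>m. val_count \<mu> k = 0)) \<and>
     (\<forall>k. val_count \<mu> k \<in> {0, 1, 3}) \<and>
     (\<forall>k. val_count \<mu> k = 3 \<longrightarrow> count \<mu> (2 ^ k) \<ge> 2)"

lemma val_count_plus [simp]: "val_count (\<mu> + \<nu>) k = val_count \<mu> k + val_count \<nu> k"
  by (simp add: val_count_def)

lemma val_count_empty [simp]: "val_count {#} k = 0"
  by (simp add: val_count_def)

lemma val_count_eq_0_iff: "val_count \<mu> k = 0 \<longleftrightarrow> (\<forall>x\<in>#\<mu>. multiplicity 2 x \<noteq> k)"
  by (auto simp: val_count_def filter_mset_eq_conv)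

lemma all_val_count_eq_0_iff: "(\<forall>k. val_count \<mu> k = 0) \<longleftrightarrow> \<mu> = {#}"
  by (metis multiset_nonemptyE val_count_empty val_count_eq_0_iff)

lemma count_list_rev_sorted_list_of_multiset:
  "count_list (rev (sorted_list_of_multiset M)) x = count M x"
  by (metis count_list_rev count_mset mset_sorted_list_of_multiset)

lemma count_list_val_seq: "count_list (val_seq \<mu>) k = val_count \<mu> k"
  unfolding val_seq_def count_list_rev_sorted_list_of_multiset val_count_def
  by (induction \<mu>) auto

lemma length_val_seq: "length (val_seq \<mu>) = size \<mu>"
  by (metis length_rev mset_sorted_list_of_multiset size_image_mset size_mset val_seq_def)

lemma set_val_seq: "set (val_seq \<mu>) = multiplicity 2 ` set_mset \<mu>"
  by (simp add: val_seq_def)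

lemma v_antimono:
  assumes "i \<ge> 1" "i \<le> j" "j \<le> size \<mu>"
  shows "v \<mu> j \<le> v \<mu> i"
proof -
  have "sorted (rev (val_seq \<mu>))"
    by (simp add: val_seq_def)
  then show ?thesis
    using assms by (auto simp: v_def sorted_rev_iff_nth_mono length_val_seq)
qed

lemma v_image: "v \<mu> ` {1..size \<mu>} = multiplicity 2 ` set_mset \<mu>"
proof -
  have "v \<mu> ` Suc ` {0..<size \<mu>} = (!) (val_seq \<mu>) ` {0..<size \<mu>}"
    unfolding image_image by (simp add: v_def)
  also have "\<dots> = set (val_seq \<mu>)"
    by (metis length_val_seq list.set_map map_nth set_upt)
  finally show ?thesis
    by (simp add: set_val_seq image_Suc_atLeastLessThan atLeastLessThanSuc_atLeastAtMost)
qed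

text \<open>The entries of \<open>v \<mu>\<close> are exactly the valuations with nonzero count, the first being the
  largest; all other valuations satisfy (b) and (c) trivially.\<close>

lemma admissible_iff_val_seq:
  assumes "\<mu> \<noteq> {#}" "0 \<notin># \<mu>"
  shows "admissible \<mu> \<longleftrightarrow>
    count_list (val_seq \<mu>) (v \<mu> 1) = 1 \<and>
    (\<forall>j. 1 < j \<and> j \<le> size \<mu> \<longrightarrow> count_list (val_seq \<mu>) (v \<mu> j) \<in> {1, 3}) \<and>
    (\<forall>j. 1 \<le> j \<and> j \<le> size \<mu> \<longrightarrow> count_list (val_seq \<mu>) (v \<mu> j) = 3 \<longrightarrow>
       count \<mu> (2 ^ v \<mu> j) \<ge> 2)"
proof -
  have size: "size \<mu> \<ge> 1"
    using assms(1) by (simp add: Suc_le_eq nonempty_has_size)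
  have pos: "val_count \<mu> k > 0 \<longleftrightarrow> (\<exists>j. 1 \<le> j \<and> j \<le> size \<mu> \<and> v \<mu> j = k)" for k
  proof -
    have "val_count \<mu> k > 0 \<longleftrightarrow> k \<in> multiplicity 2 ` set_mset \<mu>"
      using val_count_eq_0_iff[of \<mu> k] by auto
    also have "\<dots> \<longleftrightarrow> k \<in> v \<mu> ` {1..size \<mu>}"
      by (simp only: v_image)
    finally show ?thesis by auto
  qed
  have top: "val_count \<mu> k = 0" if "k > v \<mu> 1" for k
    using that pos[of k] v_antimono[of 1 _ \<mu>] by fastforce
  have max: "(\<exists>m. val_count \<mu> m = 1 \<and> (\<forall>k>m. val_count \<mu> k = 0)) \<longleftrightarrow> val_count \<mu> (v \<mu> 1) = 1"
  proof
    assume "\<exists>m. val_count \<mu> m = 1 \<and> (\<forall>k>m. val_count \<mu> k = 0)"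
    then obtain m where m: "val_count \<mu> m = 1" "\<And>k. k > m \<Longrightarrow> val_count \<mu> k = 0"
      by blast
    have "val_count \<mu> (v \<mu> 1) > 0"
      using pos size by blast
    then have "m = v \<mu> 1"
      using m top by (metis linorder_neqE_nat less_numeral_extra(3) zero_neq_one)
    with m show "val_count \<mu> (v \<mu> 1) = 1" by simp
  qed (use top in blast)
  have b: "(\<forall>k. val_count \<mu> k \<in> {0, 1, 3}) \<longleftrightarrow>
    (\<forall>j. 1 \<le> j \<and> j \<le> size \<mu> \<longrightarrow> val_count \<mu> (v \<mu> j) \<in> {1, 3})"
    using pos by (metis insert_iff less_numeral_extra(3) not_gr0)
  have c: "(\<forall>k. val_count \<mu> k = 3 \<longrightarrow> count \<mu> (2 ^ k) \<ge> 2) \<longleftrightarrow>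
    (\<forall>j. 1 \<le> j \<and> j \<le> size \<mu> \<longrightarrow> val_count \<mu> (v \<mu> j) = 3 \<longrightarrow> count \<mu> (2 ^ v \<mu> j) \<ge> 2)"
    using pos by (metis zero_less_numeral)
  have first: "(\<forall>j. 1 \<le> j \<and> j \<le> size \<mu> \<longrightarrow> P j) \<longleftrightarrow> P 1 \<and> (\<forall>j. 1 < j \<and> j \<le> size \<mu> \<longrightarrow> P j)"
    for P using size by (metis le_eq_less_or_eq)
  show ?thesis
    unfolding admissible_def count_list_val_seq max b c
      first[of "\<lambda>j. val_count \<mu> (v \<mu> j) \<in> {1, 3}"]
    using assms(2) by auto
qed

section \<open>Splitting off the odd parts\<close>

lemma val_count_double_Suc: "0 \<notin># \<nu> \<Longrightarrow> val_count (double \<nu>) (Suc k) = val_count \<nu> k"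
  by (induction \<nu>) (auto simp: val_count_def double_def multiplicity_times_same)

lemma val_count_double_0: "0 \<notin># \<nu> \<Longrightarrow> val_count (double \<nu>) 0 = 0"
  by (induction \<nu>) (auto simp: val_count_def double_def multiplicity_times_same)

lemma val_count_odd:
  assumes "\<And>x. x \<in># \<rho> \<Longrightarrow> odd x"
  shows "val_count \<rho> k = (if k = 0 then size \<rho> else 0)"
  using assms by (induction \<rho>) (auto simp: val_count_def not_dvd_imp_multiplicity_0)

lemma count_double: "count (double \<nu>) (2 * k) = count \<nu> k"
  by (induction \<nu>) (auto simp: double_def)

lemma sum_mset_double: "\<Sum>\<^sub># (double \<nu>) = 2 * \<Sum>\<^sub># \<nu>"
  by (induction \<nu>) (auto simp: double_def)

lemma double_empty [simp]: "double {#} = {#}"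
  by (simp add: double_def)

lemma double_parts_even: "x \<in># double \<nu> \<Longrightarrow> even x"
  by (auto simp: double_def)

lemma odd_even_split:
  obtains \<nu> \<rho> where "\<mu> = double \<nu> + \<rho>" "\<And>x. x \<in># \<rho> \<Longrightarrow> odd x"
proof
  have "double (image_mset (\<lambda>x. x div 2) {#x \<in># \<mu>. even x#}) = {#x \<in># \<mu>. even x#}"
    by (induction \<mu>) (auto simp: double_def)
  then show "\<mu> = double (image_mset (\<lambda>x. x div 2) {#x \<in># \<mu>. even x#}) + {#x \<in># \<mu>. odd x#}"
    by (simp flip: multiset_partition)
qed auto

lemma not_admissible_empty [simp]: "\<not> admissible {#}"
  by (simp add: admissible_def)

text \<open>The largest valuation is 0 only when there are no even parts; this is why \<open>\<nu>\<close> may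
  be empty exactly when there is a single odd part.\<close>

lemma admissible_double_plus_odd:
  assumes odd: "\<And>x. x \<in># \<rho> \<Longrightarrow> odd x"
  shows "admissible (double \<nu> + \<rho>) \<longleftrightarrow>
    (size \<rho> = 0 \<and> admissible \<nu>) \<or>
    (size \<rho> = 1 \<and> (\<nu> = {#} \<or> admissible \<nu>)) \<or>
    (size \<rho> = 3 \<and> admissible \<nu> \<and> count \<rho> 1 \<ge> 2)"
proof (cases "0 \<in># \<nu>")
  case True
  then have "0 \<in># double \<nu> + \<rho>" by (force simp: double_def)
  with True show ?thesis by (auto simp: admissible_def)
next
  case False
  define \<mu> where "\<mu> = double \<nu> + \<rho>"
  have zero: "0 \<notin># \<mu>"
    using False odd by (force simp: \<mu>_def double_def)
  have vc0: "val_count \<mu> 0 = size \<rho>"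
    using val_count_odd[OF odd, of \<rho> 0] False by (simp add: \<mu>_def val_count_double_0)
  have vcSuc: "val_count \<mu> (Suc k) = val_count \<nu> k" for k
    using val_count_odd[OF odd, of \<rho> "Suc k"] False by (simp add: \<mu>_def val_count_double_Suc)
  have c0: "count \<mu> 1 = count \<rho> 1"
    using double_parts_even[of 1 \<nu>] by (auto simp: \<mu>_def count_eq_zero_iff)
  have cSuc: "count \<mu> (2 ^ Suc k) = count \<nu> (2 ^ k)" for k
  proof -
    have "count \<rho> (2 ^ Suc k) = 0"
      using odd[of "2 ^ Suc k"] by (auto simp: count_eq_zero_iff)
    then show ?thesis by (simp add: \<mu>_def count_double)
  qed
  have all: "(\<forall>k. P k) \<longleftrightarrow> P 0 \<and> (\<forall>k. P (Suc k))" for P :: "nat \<Rightarrow> bool"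
    by (metis not0_implies_Suc)
  have ex: "(\<exists>k. P k) \<longleftrightarrow> P 0 \<or> (\<exists>k. P (Suc k))" for P :: "nat \<Rightarrow> bool"
    by (metis not0_implies_Suc)
  have max: "(\<exists>m. val_count \<mu> m = 1 \<and> (\<forall>k>m. val_count \<mu> k = 0)) \<longleftrightarrow>
    size \<rho> = 1 \<and> \<nu> = {#} \<or> (\<exists>m. val_count \<nu> m = 1 \<and> (\<forall>k>m. val_count \<nu> k = 0))"
    by (subst ex, subst (1 2) all)
      (simp add: vc0 vcSuc all_val_count_eq_0_iff)
  have b: "(\<forall>k. val_count \<mu> k \<in> {0, 1, 3}) \<longleftrightarrow>
    size \<rho> \<in> {0, 1, 3} \<and> (\<forall>k. val_count \<nu> k \<in> {0, 1, 3})"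
    by (subst all) (simp only: vc0 vcSuc)
  have c: "(\<forall>k. val_count \<mu> k = 3 \<longrightarrow> count \<mu> (2 ^ k) \<ge> 2) \<longleftrightarrow>
    (size \<rho> = 3 \<longrightarrow> count \<rho> 1 \<ge> 2) \<and> (\<forall>k. val_count \<nu> k = 3 \<longrightarrow> count \<nu> (2 ^ k) \<ge> 2)"
    by (subst all) (simp only: vc0 vcSuc cSuc c0 power_0)
  have "admissible \<mu> \<longleftrightarrow>
    (size \<rho> = 1 \<and> \<nu> = {#} \<or> (\<exists>m. val_count \<nu> m = 1 \<and> (\<forall>k>m. val_count \<nu> k = 0))) \<and>
    (size \<rho> \<in> {0, 1, 3} \<and> (\<forall>k. val_count \<nu> k \<in> {0, 1, 3})) \<and>
    (size \<rho> = 3 \<longrightarrow> count \<rho> 1 \<ge> 2) \<and> (\<forall>k. val_count \<nu> k = 3 \<longrightarrow> count \<nu> (2 ^ k) \<ge> 2)"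
    unfolding admissible_def max b c by (simp only: zero not_False_eq_True simp_thms)
  also have "\<dots> \<longleftrightarrow> (size \<rho> = 0 \<and> admissible \<nu>) \<or>
    (size \<rho> = 1 \<and> (\<nu> = {#} \<or> admissible \<nu>)) \<or>
    (size \<rho> = 3 \<and> admissible \<nu> \<and> count \<rho> 1 \<ge> 2)"
    unfolding admissible_def using False by (cases "\<nu> = {#}") auto
  finally show ?thesis
    by (simp only: \<mu>_def)
qed

lemma even_sum_mset_of_odds:
  fixes \<rho> :: "nat multiset"
  assumes "\<And>x. x \<in># \<rho> \<Longrightarrow> odd x"
  shows "even (\<Sum>\<^sub># \<rho>) \<longleftrightarrow> even (size \<rho>)"
  using assms by (induction \<rho>) auto

lemma admissible_double_iff [simp]: "admissible (double \<nu>) \<longleftrightarrow> admissible \<nu>"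
  using admissible_double_plus_odd[of "{#}" \<nu>] by simp

lemma admissible_even_sum_iff:
  "admissible \<mu> \<and> even (\<Sum>\<^sub># \<mu>) \<longleftrightarrow> (\<exists>\<nu>. \<mu> = double \<nu> \<and> admissible \<nu>)"
proof
  assume *: "admissible \<mu> \<and> even (\<Sum>\<^sub># \<mu>)"
  obtain \<nu> \<rho> where \<mu>: "\<mu> = double \<nu> + \<rho>" and odd: "\<And>x. x \<in># \<rho> \<Longrightarrow> odd x"
    using odd_even_split by blast
  have "even (size \<rho>)"
    using * even_sum_mset_of_odds[OF odd, of \<rho>] by (simp add: \<mu> sum_mset_double)
  then have "size \<rho> = 0 \<and> admissible \<nu>"
    using * admissible_double_plus_odd[OF odd, of \<rho> \<nu>] by (auto simp: \<mu>)
  then show "\<exists>\<nu>. \<mu> = double \<nu> \<and> admissible \<nu>"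
    using \<mu> by auto
qed (auto simp: sum_mset_double)

text \<open>With three odd parts, at least two of which are 1, the remaining one is the largest.
  It is singled out as \<open>r\<close>, since this is the part that \<open>odd_plus_two\<close> acts on.\<close>

lemma admissible_odd_sum_iff:
  "admissible \<mu> \<and> odd (\<Sum>\<^sub># \<mu>) \<longleftrightarrow>
    (\<exists>\<nu> r k. \<mu> = double \<nu> + add_mset r (replicate_mset k 1) \<and> odd r \<and>
       (k = 0 \<and> \<nu> = {#} \<or> k \<in> {0, 2} \<and> admissible \<nu>))"
proof
  assume *: "admissible \<mu> \<and> odd (\<Sum>\<^sub># \<mu>)"
  obtain \<nu> \<rho> where \<mu>: "\<mu> = double \<nu> + \<rho>" and odd: "\<And>x. x \<in># \<rho> \<Longrightarrow> odd x"
    using odd_even_split by blast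
  have "odd (size \<rho>)"
    using * even_sum_mset_of_odds[OF odd, of \<rho>] by (simp add: \<mu> sum_mset_double)
  then consider (one) "size \<rho> = 1" "\<nu> = {#} \<or> admissible \<nu>"
    | (three) "size \<rho> = 3" "admissible \<nu>" "count \<rho> 1 \<ge> 2"
    using * admissible_double_plus_odd[OF odd, of \<rho> \<nu>] by (auto simp: \<mu>)
  then show "\<exists>\<nu> r k. \<mu> = double \<nu> + add_mset r (replicate_mset k 1) \<and> odd r \<and>
       (k = 0 \<and> \<nu> = {#} \<or> k \<in> {0, 2} \<and> admissible \<nu>)"
  proof cases
    case one
    then obtain r where "\<rho> = {#r#}"
      by (metis size_1_singleton_mset)
    with one odd show ?thesis
      by (intro exI[of _ \<nu>] exI[of _ r] exI[of _ 0]) (auto simp: \<mu>)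
  next
    case three
    then have sub: "replicate_mset 2 1 \<subseteq># \<rho>"
      by (simp add: count_le_replicate_mset_subset_eq)
    then have "size (\<rho> - replicate_mset 2 1) = 1"
      using three by (simp add: size_Diff_submset)
    then obtain r where "\<rho> - replicate_mset 2 1 = {#r#}"
      by (metis size_1_singleton_mset)
    then have \<rho>: "\<rho> = add_mset r (replicate_mset 2 1)"
      using sub by (metis add_mset_add_single subset_mset.diff_add add.commute)
    show ?thesis
      using three odd[of r] by (intro exI[of _ \<nu>] exI[of _ r] exI[of _ 2]) (auto simp: \<mu> \<rho>)
  qed
next
  assume "\<exists>\<nu> r k. \<mu> = double \<nu> + add_mset r (replicate_mset k 1) \<and> odd r \<and>
       (k = 0 \<and> \<nu> = {#} \<or> k \<in> {0, 2} \<and> admissible \<nu>)"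
  then obtain \<nu> r k where \<mu>: "\<mu> = double \<nu> + add_mset r (replicate_mset k 1)"
    and r: "odd r" and k: "k = 0 \<and> \<nu> = {#} \<or> k \<in> {0, 2} \<and> admissible \<nu>"
    by blast
  have odds: "odd x" if "x \<in># add_mset r (replicate_mset k 1)" for x
    using that r by (auto split: if_splits)
  show "admissible \<mu> \<and> odd (\<Sum>\<^sub># \<mu>)"
    using k r admissible_double_plus_odd[OF odds, of "add_mset r (replicate_mset k 1)" \<nu>]
    by (auto simp: \<mu> sum_mset_double)
qed

lemma odd_plus_two_double_plus:
  assumes "odd r"
  shows "odd_plus_two (double \<nu> + add_mset r (replicate_mset k 1)) =
    double \<nu> + add_mset (r + 2) (replicate_mset k 1)"
proof -
  have "largest_odd_part (double \<nu> + add_mset r (replicate_mset k 1)) = r"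
    unfolding largest_odd_part_def
    using assms
    by (intro Max_eqI)
      (auto dest: double_parts_even intro: odd_pos simp: Suc_le_eq split: if_splits)
  then show ?thesis
    by (simp add: odd_plus_two_def)
qed

section \<open>The recursion for the admissible partitions of a number\<close>

definition admissible_partitions :: "nat \<Rightarrow> nat multiset set" where
  "admissible_partitions n = {\<mu>. admissible \<mu> \<and> \<Sum>\<^sub># \<mu> = n}"

lemma admissible_sum_pos: "admissible \<mu> \<Longrightarrow> \<Sum>\<^sub># \<mu> > 0"
  by (metis admissible_def gr0I multiset_nonemptyE not_admissible_empty sum_mset_0_iff)

lemma admissible_partitions_even:
  "admissible_partitions (2 * n) = double ` admissible_partitions n"
proof (intro equalityI subsetI)
  fix \<mu> assume "\<mu> \<in> admissible_partitions (2 * n)"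
  then have sum: "\<Sum>\<^sub># \<mu> = 2 * n" and "admissible \<mu> \<and> even (\<Sum>\<^sub># \<mu>)"
    by (auto simp: admissible_partitions_def)
  then obtain \<nu> where \<nu>: "\<mu> = double \<nu>" "admissible \<nu>"
    using admissible_even_sum_iff by blast
  moreover from this sum have "\<Sum>\<^sub># \<nu> = n"
    by (simp only: sum_mset_double)
  ultimately show "\<mu> \<in> double ` admissible_partitions n"
    by (simp add: admissible_partitions_def)
qed (auto simp: admissible_partitions_def sum_mset_double)

lemma admissible_partitions_oddE:
  assumes "\<mu> \<in> admissible_partitions n" "odd n"
  obtains \<nu> r k where "\<mu> = double \<nu> + add_mset r (replicate_mset k 1)" "odd r"
    "k = 0 \<and> \<nu> = {#} \<or> k \<in> {0, 2} \<and> admissible \<nu>" "2 * \<Sum>\<^sub># \<nu> + r + k = n"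
proof -
  have "admissible \<mu> \<and> odd (\<Sum>\<^sub># \<mu>)" "\<Sum>\<^sub># \<mu> = n"
    using assms by (auto simp: admissible_partitions_def)
  then show ?thesis
    unfolding admissible_odd_sum_iff using that by (fastforce simp: sum_mset_double)
qed

lemma admissible_partitions_oddI:
  assumes "odd r" "k = 0 \<and> \<nu> = {#} \<or> k \<in> {0, 2} \<and> admissible \<nu>" "2 * \<Sum>\<^sub># \<nu> + r + k = n"
  shows "double \<nu> + add_mset r (replicate_mset k 1) \<in> admissible_partitions n"
proof -
  have "admissible (double \<nu> + add_mset r (replicate_mset k 1))"
    using admissible_odd_sum_iff assms(1,2) by blast
  then show ?thesis
    using assms(3) by (simp add: admissible_partitions_def sum_mset_double)
qed

lemma admissible_partitions_1: "admissible_partitions 1 = {{#1#}}"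
proof
  show "admissible_partitions 1 \<subseteq> {{#1#}}"
  proof
    fix \<mu> assume "\<mu> \<in> admissible_partitions 1"
    then show "\<mu> \<in> {{#1#}}"
      by (rule admissible_partitions_oddE) (auto dest: admissible_sum_pos elim: oddE)
  qed
  show "{{#1#}} \<subseteq> admissible_partitions 1"
    using admissible_partitions_oddI[of 1 0 "{#}" 1] by simp
qed

lemma admissible_partitions_3: "admissible_partitions 3 = {{#3#}, {#2, 1#}}"
proof
  show "admissible_partitions 3 \<subseteq> {{#3#}, {#2, 1#}}"
  proof
    fix \<mu> assume "\<mu> \<in> admissible_partitions 3"
    then show "\<mu> \<in> {{#3#}, {#2, 1#}}"
    proof (rule admissible_partitions_oddE)
      fix \<nu> r k
      assume \<mu>: "\<mu> = double \<nu> + add_mset r (replicate_mset k 1)" and r: "odd r"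
        and k: "k = 0 \<and> \<nu> = {#} \<or> k \<in> {0, 2} \<and> admissible \<nu>"
        and sum: "2 * \<Sum>\<^sub># \<nu> + r + k = 3"
      show ?thesis
      proof (cases "\<nu> = {#}")
        case True
        with k sum show ?thesis by (auto simp: \<mu>)
      next
        case False
        with k have "admissible \<nu>" by blast
        moreover from this have "\<Sum>\<^sub># \<nu> = 1" "k = 0" "r = 1"
          using admissible_sum_pos[of \<nu>] sum r k by (auto elim!: oddE)
        ultimately have "\<nu> = {#1#}"
          using admissible_partitions_1 by (auto simp: admissible_partitions_def)
        then show ?thesis
          using \<open>k = 0\<close> \<open>r = 1\<close> by (simp add: \<mu> double_def)
      qed
    qed simp
  qed
  have "admissible {#1#}"
    using admissible_partitions_1 by (auto simp: admissible_partitions_def)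
  then show "{{#3#}, {#2, 1#}} \<subseteq> admissible_partitions 3"
    using admissible_partitions_oddI[of 3 0 "{#}" 3] admissible_partitions_oddI[of 1 0 "{#1#}" 3]
    by (simp add: double_def add_mset_commute)
qed

lemma replicate_mset_2: "replicate_mset 2 x = {#x, x#}"
  by (simp add: numeral_2_eq_2)

lemma admissible_partitions_odd:
  assumes "n \<ge> 1"
  shows "admissible_partitions (2 * n + 3) =
     (\<lambda>\<nu>. \<nu> + {#1#}) ` admissible_partitions (2 * n + 2) \<union>
     odd_plus_two ` admissible_partitions (2 * n + 1) \<union>
     (\<lambda>\<nu>. \<nu> + {#1, 1, 1#}) ` admissible_partitions (2 * n)"
    (is "_ = ?A \<union> ?B \<union> ?C")
proof (intro equalityI subsetI)
  fix \<mu> assume "\<mu> \<in> admissible_partitions (2 * n + 3)"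
  then show "\<mu> \<in> ?A \<union> ?B \<union> ?C"
  proof (rule admissible_partitions_oddE)
    fix \<nu> r k
    assume \<mu>: "\<mu> = double \<nu> + add_mset r (replicate_mset k 1)" and r: "odd r"
      and k: "k = 0 \<and> \<nu> = {#} \<or> k \<in> {0, 2} \<and> admissible \<nu>"
      and sum: "2 * \<Sum>\<^sub># \<nu> + r + k = 2 * n + 3"
    show ?thesis
    proof (cases "r = 1")
      case True
      (* If \<nu> were empty, the partition would be (1), whose sum is too small. *)
      with sum assms k have adm: "admissible \<nu>" "k = 0 \<or> k = 2" by auto
      from adm(2) show ?thesis
      proof
        assume "k = 0"
        then have "double \<nu> \<in> admissible_partitions (2 * n + 2)"
          using adm True sum by (simp add: admissible_partitions_def sum_mset_double)
        then have "\<mu> \<in> ?A"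
          by (rule rev_image_eqI) (simp add: \<mu> True \<open>k = 0\<close>)
        then show ?thesis by blast
      next
        assume "k = 2"
        then have "double \<nu> \<in> admissible_partitions (2 * n)"
          using adm True sum by (simp add: admissible_partitions_def sum_mset_double)
        then have "\<mu> \<in> ?C"
          by (rule rev_image_eqI) (simp add: \<mu> True \<open>k = 2\<close> replicate_mset_2)
        then show ?thesis by blast
      qed
    next
      case False
      with r obtain s where s: "r = s + 2" "odd s"
        by (metis add_2_eq_Suc' even_Suc not0_implies_Suc odd_one One_nat_def even_zero)
      have "double \<nu> + add_mset s (replicate_mset k 1) \<in> admissible_partitions (2 * n + 1)"
        using s k sum by (intro admissible_partitions_oddI) auto
      then have "\<mu> \<in> ?B"
        by (rule rev_image_eqI) (simp only: odd_plus_two_double_plus[OF s(2)] s(1) \<mu>)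
      then show ?thesis by blast
    qed
  qed simp
next
  fix \<mu> assume "\<mu> \<in> ?A \<union> ?B \<union> ?C"
  then consider (A) "\<mu> \<in> ?A" | (B) "\<mu> \<in> ?B" | (C) "\<mu> \<in> ?C" by blast
  then show "\<mu> \<in> admissible_partitions (2 * n + 3)"
  proof cases
    case A
    then obtain \<nu> where "\<mu> = double \<nu> + {#1#}" "\<nu> \<in> admissible_partitions (n + 1)"
      using admissible_partitions_even[of "n + 1"] by auto
    then show ?thesis
      using admissible_partitions_oddI[of 1 0 \<nu> "2 * n + 3"]
      by (simp add: admissible_partitions_def)
  next
    case B
    then obtain \<mu>' where \<mu>': "\<mu> = odd_plus_two \<mu>'" "\<mu>' \<in> admissible_partitions (2 * n + 1)"
      by blast
    from this(2) show ?thesis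
    proof (rule admissible_partitions_oddE)
      fix \<nu> r k
      assume *: "\<mu>' = double \<nu> + add_mset r (replicate_mset k 1)" "odd r"
        "k = 0 \<and> \<nu> = {#} \<or> k \<in> {0, 2} \<and> admissible \<nu>" "2 * \<Sum>\<^sub># \<nu> + r + k = 2 * n + 1"
      show ?thesis
        unfolding \<mu>'(1) *(1) odd_plus_two_double_plus[OF *(2)]
        using * by (intro admissible_partitions_oddI) auto
    qed simp
  next
    case C
    then obtain \<nu> where "\<mu> = double \<nu> + {#1, 1, 1#}" "\<nu> \<in> admissible_partitions n"
      using admissible_partitions_even[of n] by auto
    then show ?thesis
      using admissible_partitions_oddI[of 1 2 \<nu> "2 * n + 3"]
      by (simp add: admissible_partitions_def replicate_mset_2)
  qed
qed

lemma ST_eq_admissible_partitions: "ST n = admissible_partitions n"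
proof (induction n rule: ST.induct)
  case 1
  have "\<Sum>\<^sub># \<mu> \<noteq> 0" if "admissible \<mu>" for \<mu>
    using admissible_sum_pos[OF that] by (rule gr_implies_not0)
  then have "admissible_partitions 0 = {}"
    unfolding admissible_partitions_def by blast
  then show ?case by (simp only: ST.simps(1))
next
  case 2
  show ?case by (simp only: ST.simps(2) admissible_partitions_1)
next
  case 3
  show ?case by (simp only: ST.simps(3) admissible_partitions_3)
next
  case (4 n)
  show ?case by (simp only: ST.simps(4)[OF 4(1)] 4(2) admissible_partitions_even)
next
  case (5 n)
  show ?case by (simp only: ST.simps(5)[OF 5(1)] 5(2-4) admissible_partitions_odd[OF 5(1)])
qed

theorem theorem4p3:
  fixes n :: nat
  assumes "n > 0"
  shows "ST n = {\<mu> \<in> partitions n.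
    count_list (val_seq \<mu>) (v \<mu> 1) = 1 \<and>
    (\<forall>j. 1 < j \<and> j \<le> size \<mu> \<longrightarrow> count_list (val_seq \<mu>) (v \<mu> j) \<in> {1, 3}) \<and>
    (\<forall>j. 1 \<le> j \<and> j \<le> size \<mu> \<longrightarrow> count_list (val_seq \<mu>) (v \<mu> j) = 3 \<longrightarrow>
       count \<mu> (2 ^ v \<mu> j) \<ge> 2)}"
proof -
  have "ST n = {\<mu> \<in> partitions n. admissible \<mu>}"
    unfolding ST_eq_admissible_partitions
    by (auto simp: admissible_partitions_def partitions_def admissible_def)
  also have "\<mu> \<noteq> {#} \<and> 0 \<notin># \<mu>" if "\<mu> \<in> partitions n" for \<mu>
    using that assms by (auto simp: partitions_def)
  then have "{\<mu> \<in> partitions n. admissible \<mu>} = {\<mu> \<in> partitions n.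
    count_list (val_seq \<mu>) (v \<mu> 1) = 1 \<and>
    (\<forall>j. 1 < j \<and> j \<le> size \<mu> \<longrightarrow> count_list (val_seq \<mu>) (v \<mu> j) \<in> {1, 3}) \<and>
    (\<forall>j. 1 \<le> j \<and> j \<le> size \<mu> \<longrightarrow> count_list (val_seq \<mu>) (v \<mu> j) = 3 \<longrightarrow>
       count \<mu> (2 ^ v \<mu> j) \<ge> 2)}"
    using admissible_iff_val_seq by (intro Collect_cong conj_cong refl) blast
  finally show ?thesis .
qed

end
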